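(* Let $n\ge 2$ be an integer. If the inequality $$\mathrm{vol}(A)\,\mathrm{vol}(P_{\{n\}}A)^{n-2}\ \le\ \prod_{\ell=1}^{n-1}\mathrm{vol}(P_{\{\ell,n\}}A)$$ holds for every zonotope $A\in\mathcal Z^n_{2^{n-1}}$, then it holds for every zonotope $A\in\mathcal Z^n_m$ for every $m\ge n$.
   Context: A zonotope is a Minkowski sum of finitely many line segments (its generators); $\mathcal Z^n_m$ denotes the family of all zonotopes in $\mathbb R^n$ generated by at most $m$ segments. For $I\subseteq\{1,\dots,n\}$, $P_I$ is the orthogonal projection of $\mathbb R^n$ onto the coordinate subspace spanned by the standard basis vectors $e_i$, $i\in I$, and $\mathrm{vol}(P_IA)$ is the $|I|$-dimensional volume of $P_IA$ in that subspace. *)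

theory Defs
  imports "HOL-Analysis.Analysis" "HOL-Library.Set_Algebras"
begin

text \<open>
  The big sum is the Minkowski sum of sets in the sense of HOL-Library; the empty sum is \<open>{0}\<close>.
  Segments may be degenerate (single points).
\<close>

definition zonotopes :: "nat \<Rightarrow> (real ^ 'n) set set" where
  "zonotopes m =
     {A. \<exists>k\<le>m. \<exists>a b :: nat \<Rightarrow> real ^ 'n. A = (\<Sum>i<k. closed_segment (a i) (b i))}"

definition coord_proj :: "'n set \<Rightarrow> real ^ 'n \<Rightarrow> real ^ 'n" where
  "coord_proj I x = (\<chi> i. if i \<in> I then x $ i else 0)"

text \<open>
  The \<open>card I\<close>-dimensional volume of a set \<open>B\<close> contained in the coordinate subspace spanned by
  the \<open>axis i 1\<close> with \<open>i \<in> I\<close>: that subspace is identified isometrically with the functions on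
  \<open>I\<close>, which carry the product Lebesgue measure. For \<open>B\<close> not contained in the subspace the
  value is that of its projection.
\<close>

definition coord_vol :: "'n set \<Rightarrow> (real ^ 'n) set \<Rightarrow> real" where
  "coord_vol I B = measure (\<Pi>\<^sub>M i\<in>I. lborel) ((\<lambda>x. \<lambda>i\<in>I. x $ i) ` B)"

text \<open>
  The index \<open>d\<close> plays the role of the last coordinate \<open>n\<close>, where \<open>n = CARD('n)\<close>; the other
  indices are those in \<open>UNIV - {d}\<close>.
\<close>

definition zonotope_ineq :: "'n \<Rightarrow> (real ^ 'n) set \<Rightarrow> bool" where
  "zonotope_ineq d A \<longleftrightarrow>
     measure lebesgue A * coord_vol {d} (coord_proj {d} ` A) ^ (CARD('n) - 2)
       \<le> (\<Prod>l\<in>UNIV - {d}. coord_vol {l, d} (coord_proj {l, d} ` A))"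

end

(*
  A zonotope is p + T([0,1]^k) for a matrix T whose columns are the generators; flip generators so that
  row d of T is nonnegative. By Fubini in the coordinate l, the volume is the integral of the widths,
  in the direction of row l, of the slices of the cube cut out by the other rows. Width is sublinear
  in the direction, so the volume is subadditive in row l. In the plane {l, d} optimising over a slice
  is a fractional knapsack problem: if row l is split along the superlevel sets of its ratio to row d,
  one greedy solution maximises all the pieces simultaneously, so the planar area is superadditive.
  Hence row l may be replaced by one piece: row d restricted to a subset of the generators, or a row
  supported on a single generator with vanishing d-coordinate. Once all rows have this form,
  generators with the same support are parallel, so at most 2^(n-1) segments remain.
*)
theory Submission imports Defs begin

section \<open>Zonotopes as affine images of the cube; Lebesgue measure as a product measure\<close>

section \<open>Volumes of zonotopes in coordinates\<close>

interpretation lborel_prod: product_sigma_finite "\<lambda>_::'n. lborel :: real measure"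
  by standard

text \<open>Points are total functions, so that one cube serves every number of generators:
  \<open>dot k\<close> reads only the first \<open>k\<close> coordinates.\<close>

definition unit_cube :: "(nat \<Rightarrow> real) set" where
  "unit_cube = {s. \<forall>i. 0 \<le> s i \<and> s i \<le> 1}"

definition dot :: "nat \<Rightarrow> (nat \<Rightarrow> real) \<Rightarrow> (nat \<Rightarrow> real) \<Rightarrow> real" where
  "dot k r s = (\<Sum>i<k. r i * s i)"

text \<open>The matrix is stored by rows, indexed by the coordinates of the space, because the
  reduction changes one row at a time; the generators are its columns.\<close>

definition zono :: "real ^ 'n \<Rightarrow> nat \<Rightarrow> ('n \<Rightarrow> nat \<Rightarrow> real) \<Rightarrow> (real ^ 'n) set" where
  "zono p k T = (\<lambda>s. \<chi> l. p $ l + dot k (T l) s) ` unit_cube"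

text \<open>Values in \<open>ennreal\<close> allow Fubini and slicewise comparison without
  integrability conditions; \<open>coord_emeasure_finite\<close> leads back to
  \<open>coord_vol\<close>.\<close>

definition coord_emeasure :: "'n set \<Rightarrow> (real ^ 'n) set \<Rightarrow> ennreal" where
  "coord_emeasure I A = emeasure (\<Pi>\<^sub>M i\<in>I. lborel) ((\<lambda>x. \<lambda>i\<in>I. x $ i) ` A)"

lemma zono_eq_sum:
  "zono p k T = {p} + (\<Sum>i<k. closed_segment 0 (\<chi> l. T l i))"
proof (induction k)
  case 0
  have "(\<lambda>_. 0) \<in> unit_cube" by (simp add: unit_cube_def)
  then show ?case by (auto simp: zono_def dot_def vec_eq_iff image_iff)
next
  case (Suc k)
  have "zono p (Suc k) T = zono p k T + closed_segment 0 (\<chi> l. T l k)"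
  proof (intro equalityI subsetI)
    fix x assume "x \<in> zono p (Suc k) T"
    then obtain s where s: "s \<in> unit_cube" and x: "x = (\<chi> l. p $ l + dot (Suc k) (T l) s)"
      by (auto simp: zono_def)
    have "x = (\<chi> l. p $ l + dot k (T l) s) + s k *\<^sub>R (\<chi> l. T l k)"
      by (simp add: x dot_def vec_eq_iff algebra_simps)
    moreover have "s k *\<^sub>R (\<chi> l. T l k) \<in> closed_segment 0 (\<chi> l. T l k)"
      using s by (auto simp: in_segment unit_cube_def)
    ultimately show "x \<in> zono p k T + closed_segment 0 (\<chi> l. T l k)"
      using s by (auto simp: zono_def)
  next
    fix x assume "x \<in> zono p k T + closed_segment 0 (\<chi> l. T l k)"
    then obtain s t where s: "s \<in> unit_cube" and t: "0 \<le> t" "t \<le> 1"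
      and x: "x = (\<chi> l. p $ l + dot k (T l) s) + t *\<^sub>R (\<chi> l. T l k)"
      by (auto simp: zono_def in_segment elim!: set_plus_elim)
    \<comment> \<open>Overwriting coordinate \<open>k\<close> leaves \<open>dot k\<close> untouched,
      so the new segment gets its own parameter.\<close>
    have "x = (\<chi> l. p $ l + dot (Suc k) (T l) (s(k := t)))"
      by (simp add: x dot_def vec_eq_iff algebra_simps)
    moreover have "s(k := t) \<in> unit_cube" using s t by (auto simp: unit_cube_def)
    ultimately show "x \<in> zono p (Suc k) T" by (auto simp: zono_def)
  qed
  then show ?case by (simp add: Suc.IH add.assoc)
qed

lemma compact_sum_sets:
  fixes F :: "'i \<Rightarrow> 'a::real_normed_vector set"
  shows "finite S \<Longrightarrow> (\<And>i. i \<in> S \<Longrightarrow> compact (F i)) \<Longrightarrow> compact (\<Sum>i\<in>S. F i)"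
proof (induction rule: finite_induct)
  case (insert i S)
  have "F i + (\<Sum>i\<in>S. F i) = (\<Union>x\<in>F i. \<Union>y\<in>(\<Sum>i\<in>S. F i). {x + y})"
    by (auto simp: set_plus_def)
  then show ?case using insert by (simp add: compact_sums')
qed simp

lemma compact_zono: "compact (zono p k T)"
proof -
  have "{p} + (\<Sum>i<k. closed_segment 0 (\<chi> l. T l i))
      = (\<Union>x\<in>{p}. \<Union>y\<in>(\<Sum>i<k. closed_segment 0 (\<chi> l. T l i)). {x + y})"
    by (auto simp: set_plus_def)
  then show ?thesis
    unfolding zono_eq_sum by (simp only: compact_sums' compact_sing compact_sum_sets compact_segment finite_lessThan)
qed

lemma measurable_vec_lambda_restrict [measurable]:
  "(\<lambda>f. \<chi> i. if i \<in> I then f i else 0) \<in> (\<Pi>\<^sub>M i\<in>I. lborel) \<rightarrow>\<^sub>M (borel :: (real ^ 'n) measure)"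
proof (subst borel_measurable_euclidean_space, intro ballI)
  fix b :: "real ^ 'n" assume "b \<in> Basis"
  then obtain j where b: "b = axis j 1" by (auto simp: Basis_vec_def)
  show "(\<lambda>f. (\<chi> i. if i \<in> I then f i else 0) \<bullet> b) \<in> borel_measurable (\<Pi>\<^sub>M i\<in>I. lborel)"
    by (cases "j \<in> I") (simp_all add: b inner_axis)
qed

text \<open>The set is the preimage, under extension by zero, of a coordinate projection of
  \<open>A\<close>; that projection is a continuous image of a compact set, hence Borel.\<close>

lemma sets_restrict_compact:
  fixes A :: "(real ^ 'n) set"
  assumes "compact A"
  shows "(\<lambda>x. \<lambda>i\<in>I. x $ i) ` A \<in> sets (\<Pi>\<^sub>M i\<in>I. lborel)"
proof -
  let ?g = "\<lambda>f. (\<chi> i. if i \<in> I then f i else 0) :: real ^ 'n"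
  have "compact (coord_proj I ` A)"
    unfolding coord_proj_def
  proof (intro compact_continuous_image assms continuous_on_vec_lambda)
    show "continuous_on A (\<lambda>x. if i \<in> I then x $ i else 0)" for i
      by (cases "i \<in> I") (auto intro!: continuous_intros)
  qed
  then have "coord_proj I ` A \<in> sets borel" by (intro borel_closed compact_imp_closed)
  then have "?g -` (coord_proj I ` A) \<inter> space (\<Pi>\<^sub>M i\<in>I. lborel) \<in> sets (\<Pi>\<^sub>M i\<in>I. lborel)"
    by measurable
  also have "?g -` (coord_proj I ` A) \<inter> space (\<Pi>\<^sub>M i\<in>I. lborel) = (\<lambda>x. \<lambda>i\<in>I. x $ i) ` A"
    (is "?L = ?R")
  proof (intro equalityI subsetI)
    fix f assume "f \<in> ?L"
    then obtain x where x: "x \<in> A" "?g f = coord_proj I x" and f: "f \<in> extensional I"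
      by (auto simp: space_PiM PiE_def)
    from x(2) have "f i = x $ i" if "i \<in> I" for i
      using that by (auto simp: coord_proj_def vec_eq_iff split: if_splits)
    then have "f = (\<lambda>i\<in>I. x $ i)" using f by (auto simp: extensional_def)
    then show "f \<in> ?R" using x by blast
  qed (auto simp: space_PiM coord_proj_def vec_eq_iff cong: if_cong)
  finally show ?thesis .
qed

lemma coord_emeasure_finite:
  fixes A :: "(real ^ 'n) set"
  assumes "compact A"
  shows "coord_emeasure I A < \<infinity>"
proof -
  obtain a where a: "A \<subseteq> cbox (-a) a"
    using bounded_subset_cbox_symmetric compact_imp_bounded assms by blast
  have "coord_emeasure I A \<le> emeasure (\<Pi>\<^sub>M i\<in>I. lborel) (\<Pi>\<^sub>E i\<in>I. {(-a) $ i..a $ i})"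
    unfolding coord_emeasure_def
    using a by (intro emeasure_mono) (auto simp: mem_box_cart sets_PiM_I_finite subset_iff)
  also have "\<dots> = (\<Prod>i\<in>I. emeasure lborel {(-a) $ i..a $ i})"
    by (rule lborel_prod.emeasure_PiM) auto
  also have "\<dots> < \<infinity>"
    by (auto simp: less_top[symmetric] ennreal_prod_eq_top emeasure_lborel_Icc_eq)
  finally show ?thesis .
qed

text \<open>Lebesgue measure is determined by its values on open boxes, and the product measure
  gives a box the product of its side lengths.\<close>

lemma lborel_vec_eq:
  "(lborel :: (real ^ 'n) measure) = distr (\<Pi>\<^sub>M i\<in>(UNIV :: 'n set). lborel) borel (\<lambda>f. \<chi> i. f i)"
proof (rule lborel_eqI)
  fix l u :: "real ^ 'n" assume le: "\<And>b. b \<in> Basis \<Longrightarrow> l \<bullet> b \<le> u \<bullet> b"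
  then have le': "l $ i \<le> u $ i" for i
    by (force simp: Basis_vec_def inner_axis)
  have m: "(\<lambda>f. \<chi> i. f i) \<in> (\<Pi>\<^sub>M i\<in>(UNIV :: 'n set). lborel) \<rightarrow>\<^sub>M (borel :: (real ^ 'n) measure)"
    using measurable_vec_lambda_restrict[of UNIV] by simp
  have "emeasure (distr (\<Pi>\<^sub>M i\<in>(UNIV :: 'n set). lborel) borel (\<lambda>f. \<chi> i. f i)) (box l u)
      = emeasure (\<Pi>\<^sub>M i\<in>(UNIV :: 'n set). lborel) (\<Pi>\<^sub>E i\<in>UNIV. {l $ i<..<u $ i})"
    by (subst emeasure_distr[OF m]) (auto intro!: arg_cong2[where f=emeasure] simp: space_PiM mem_box_cart PiE_iff)
  also have "\<dots> = (\<Prod>i\<in>(UNIV :: 'n set). emeasure lborel {l $ i<..<u $ i})"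
    by (rule lborel_prod.emeasure_PiM) auto
  also have "\<dots> = (\<Prod>i\<in>(UNIV :: 'n set). ennreal (u $ i - l $ i))"
    using le' by simp
  also have "\<dots> = (\<Prod>b\<in>Basis. (u - l) \<bullet> b)"
    using le' by (subst prod_ennreal) (auto simp: Basis_vec_def inner_axis axis_eq_axis prod.UNION_disjoint
      intro!: arg_cong[where f=ennreal] prod.reindex_bij_witness[where i="\<lambda>b. THE i. b = axis i 1" and j="\<lambda>i. axis i 1"])
  finally show "emeasure (distr (\<Pi>\<^sub>M i\<in>(UNIV :: 'n set). lborel) borel (\<lambda>f. \<chi> i. f i)) (box l u)
     = (\<Prod>b\<in>Basis. (u - l) \<bullet> b)" .
qed simp

text \<open>Puts the full volume in the same form as the planar ones, so that one slicing formula
  serves both.\<close>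

lemma measure_lebesgue_eq_coord_vol:
  fixes A :: "(real ^ 'n) set"
  assumes "compact A"
  shows "measure lebesgue A = coord_vol UNIV A"
proof -
  have A: "A \<in> sets borel" using assms by (intro borel_closed compact_imp_closed)
  have m: "(\<lambda>f. \<chi> i. f i) \<in> (\<Pi>\<^sub>M i\<in>(UNIV :: 'n set). lborel) \<rightarrow>\<^sub>M (borel :: (real ^ 'n) measure)"
    using measurable_vec_lambda_restrict[of UNIV] by simp
  have "measure lebesgue A = measure lborel A" using A by (simp add: measure_completion)
  also have "\<dots> = measure (\<Pi>\<^sub>M i\<in>(UNIV :: 'n set). lborel) ((\<lambda>f. \<chi> i. f i) -` A)"
    by (subst lborel_vec_eq, subst measure_distr[OF m A]) (simp add: space_PiM)
  also have "(\<lambda>f. \<chi> i. f i) -` A = (\<lambda>x. \<lambda>i\<in>UNIV. x $ i) ` A"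
    by (auto simp: image_iff restrict_def fun_eq_iff vec_lambda_eta intro!: bexI[of _ "\<chi> i. _ i"])
  finally show ?thesis by (simp add: coord_vol_def)
qed

lemma coord_vol_coord_proj: "coord_vol I (coord_proj I ` A) = coord_vol I A"
  by (simp add: coord_vol_def coord_proj_def image_image cong: restrict_cong)

lemma coord_vol_eq: "coord_vol I A = enn2real (coord_emeasure I A)"
  by (simp add: coord_vol_def coord_emeasure_def measure_def)

section \<open>Volume as an integral of the widths of slices of the cube\<close>

section \<open>Slicing\<close>

text \<open>A slice of the parameter cube rather than of the zonotope: it does not change when a row
  outside \<open>J\<close> is altered, so different choices of such a row are compared over the same
  set.\<close>

definition fibre :: "real ^ 'n \<Rightarrow> nat \<Rightarrow> 'n set \<Rightarrow> ('n \<Rightarrow> nat \<Rightarrow> real) \<Rightarrow> ('n \<Rightarrow> real) \<Rightarrow> (nat \<Rightarrow> real) set" where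
  "fibre p k J T y = {s \<in> unit_cube. \<forall>j\<in>J. y j = p $ j + dot k (T j) s}"

text \<open>For \<open>l\<close> outside \<open>J\<close> this is the section in direction
  \<open>l\<close> of the projected zonotope, as \<open>update_in_restrict_zono_iff\<close>
  shows.\<close>

definition fibre_image ::
  "'n \<Rightarrow> real ^ 'n \<Rightarrow> nat \<Rightarrow> 'n set \<Rightarrow> ('n \<Rightarrow> nat \<Rightarrow> real) \<Rightarrow> ('n \<Rightarrow> real) \<Rightarrow> real set" where
  "fibre_image l p k J T y = (\<lambda>s. p $ l + dot k (T l) s) ` fibre p k J T y"

text \<open>The cube consists of infinite sequences, so compactness is taken from the zonotope: the
  set is the \<open>l\<close>-coordinate of the part of the zonotope that lies on the hyperplanes
  prescribed by \<open>y\<close>.\<close>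

lemma compact_fibre_image:
  fixes l :: "'n::finite"
  shows "compact (fibre_image l p k J T y)"
proof -
  have "fibre_image l p k J T y = (\<lambda>x. x $ l) ` (zono p k T \<inter> (\<Inter>j\<in>J. {x. x $ j = y j}))"
    by (force simp: fibre_image_def fibre_def zono_def image_iff)
  moreover have "closed {x :: real ^ 'n. x $ j = y j}" for j
    by (intro closed_Collect_eq continuous_intros)
  ultimately show ?thesis
    by (auto intro!: compact_continuous_image continuous_intros compact_Int_closed compact_zono)
qed

lemma sets_fibre_image [measurable]:
  fixes l :: "'n::finite"
  shows "fibre_image l p k J T y \<in> sets borel"
  by (rule borel_closed[OF compact_imp_closed[OF compact_fibre_image]])

text \<open>Being a point of the product space makes \<open>y\<close> extensional, which the
  backward direction uses to identify the updated function with a restricted vector.\<close>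

lemma update_in_restrict_zono_iff:
  fixes T :: "'n::finite \<Rightarrow> nat \<Rightarrow> real"
  assumes "l \<notin> J" "y \<in> space (\<Pi>\<^sub>M i\<in>J. lborel)"
  shows "y(l := t) \<in> (\<lambda>x. \<lambda>i\<in>insert l J. x $ i) ` zono p k T \<longleftrightarrow> t \<in> fibre_image l p k J T y"
proof
  assume "y(l := t) \<in> (\<lambda>x. \<lambda>i\<in>insert l J. x $ i) ` zono p k T"
  then obtain s where s: "s \<in> unit_cube"
    and eq: "y(l := t) = (\<lambda>i\<in>insert l J. p $ i + dot k (T i) s)"
    by (auto simp: zono_def image_iff cong: restrict_cong)
  have "t = p $ l + dot k (T l) s" using fun_cong[OF eq, of l] by simp
  moreover have "y j = p $ j + dot k (T j) s" if "j \<in> J" for j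
    using fun_cong[OF eq, of j] that assms(1) by (auto split: if_splits)
  ultimately show "t \<in> fibre_image l p k J T y" using s by (auto simp: fibre_image_def fibre_def)
next
  assume "t \<in> fibre_image l p k J T y"
  then obtain s where s: "s \<in> unit_cube" "\<And>j. j \<in> J \<Longrightarrow> y j = p $ j + dot k (T j) s"
    "t = p $ l + dot k (T l) s"
    by (auto simp: fibre_image_def fibre_def)
  have "y(l := t) = (\<lambda>i\<in>insert l J. (\<chi> l. p $ l + dot k (T l) s) $ i)"
    using s assms by (auto simp: space_PiM PiE_def extensional_def fun_eq_iff)
  then show "y(l := t) \<in> (\<lambda>x. \<lambda>i\<in>insert l J. x $ i) ` zono p k T"
    using s(1) unfolding zono_def by blast
qed

lemma emeasure_fibre_image_eq:
  fixes T :: "'n::finite \<Rightarrow> nat \<Rightarrow> real"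
  assumes "l \<notin> J" "y \<in> space (\<Pi>\<^sub>M i\<in>J. lborel)"
  shows "(\<integral>\<^sup>+t. indicator ((\<lambda>x. \<lambda>i\<in>insert l J. x $ i) ` zono p k T) (y(l := t)) \<partial>lborel)
    = emeasure lborel (fibre_image l p k J T y)"
proof -
  have "(\<lambda>t. indicator ((\<lambda>x. \<lambda>i\<in>insert l J. x $ i) ` zono p k T) (y(l := t)) :: ennreal)
      = indicator (fibre_image l p k J T y)"
    by (auto simp: fun_eq_iff indicator_def update_in_restrict_zono_iff[OF assms])
  then show ?thesis by simp
qed

lemma measurable_emeasure_fibre_image:
  fixes T :: "'n::finite \<Rightarrow> nat \<Rightarrow> real"
  assumes "l \<notin> J"
  shows "(\<lambda>y. emeasure lborel (fibre_image l p k J T y)) \<in> borel_measurable (\<Pi>\<^sub>M i\<in>J. lborel)"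
proof -
  have [measurable]: "(\<lambda>x. \<lambda>i\<in>insert l J. x $ i) ` zono p k T \<in> sets (\<Pi>\<^sub>M i\<in>insert l J. lborel)"
    by (rule sets_restrict_compact[OF compact_zono])
  have "(\<lambda>y. \<integral>\<^sup>+t. indicator ((\<lambda>x. \<lambda>i\<in>insert l J. x $ i) ` zono p k T) (y(l := t)) \<partial>lborel)
      \<in> borel_measurable (\<Pi>\<^sub>M i\<in>J. lborel)"
    by measurable
  then show ?thesis
    by (subst measurable_cong[OF emeasure_fibre_image_eq[OF assms, symmetric]])
qed

lemma coord_emeasure_insert:
  fixes T :: "'n::finite \<Rightarrow> nat \<Rightarrow> real"
  assumes "l \<notin> J"
  shows "coord_emeasure (insert l J) (zono p k T)
    = (\<integral>\<^sup>+y. emeasure lborel (fibre_image l p k J T y) \<partial>(\<Pi>\<^sub>M i\<in>J. lborel))"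
proof -
  let ?B = "(\<lambda>x. \<lambda>i\<in>insert l J. x $ i) ` zono p k T"
  have [measurable]: "?B \<in> sets (\<Pi>\<^sub>M i\<in>insert l J. lborel)"
    by (rule sets_restrict_compact[OF compact_zono])
  have "coord_emeasure (insert l J) (zono p k T) = (\<integral>\<^sup>+x. indicator ?B x \<partial>(\<Pi>\<^sub>M i\<in>insert l J. lborel))"
    by (simp add: coord_emeasure_def)
  also have "\<dots> = (\<integral>\<^sup>+y. (\<integral>\<^sup>+t. indicator ?B (y(l := t)) \<partial>lborel) \<partial>(\<Pi>\<^sub>M i\<in>J. lborel))"
    using assms by (intro lborel_prod.product_nn_integral_insert) auto
  also have "\<dots> = (\<integral>\<^sup>+y. emeasure lborel (fibre_image l p k J T y) \<partial>(\<Pi>\<^sub>M i\<in>J. lborel))"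
    by (rule nn_integral_cong) (rule emeasure_fibre_image_eq[OF assms])
  finally show ?thesis .
qed

text \<open>Slices are convex: the segment from \<open>s\<close> to \<open>s'\<close> stays in the
  slice and sweeps the whole interval between the two values of row \<open>l\<close>. A negative
  difference is read as 0 by \<open>ennreal\<close>.\<close>

lemma fibre_image_ge:
  fixes T :: "'n::finite \<Rightarrow> nat \<Rightarrow> real"
  assumes s: "s \<in> fibre p k J T y" and s': "s' \<in> fibre p k J T y"
  shows "ennreal (dot k (T l) s' - dot k (T l) s) \<le> emeasure lborel (fibre_image l p k J T y)"
proof (cases "dot k (T l) s < dot k (T l) s'")
  case True
  define a where "a = p $ l + dot k (T l) s"
  define b where "b = p $ l + dot k (T l) s'"
  have ab: "a < b" using True by (simp add: a_def b_def)
  have "{a..b} \<subseteq> fibre_image l p k J T y"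
  proof
    fix t assume t: "t \<in> {a..b}"
    define u where "u = (t - a) / (b - a)"
    have u: "0 \<le> u" "u \<le> 1" using t ab by (auto simp: u_def)
    define r where "r = (\<lambda>i. (1 - u) * s i + u * s' i)"
    have dr: "dot k R r = (1 - u) * dot k R s + u * dot k R s'" for R
      by (simp add: dot_def r_def sum_distrib_left sum.distrib[symmetric] algebra_simps)
    have "r \<in> unit_cube"
      using s s' u unfolding r_def fibre_def unit_cube_def
      by (auto intro!: convex_bound_le)
    moreover have "y j = p $ j + dot k (T j) r" if "j \<in> J" for j
    proof -
      have "dot k (T j) s = y j - p $ j" "dot k (T j) s' = y j - p $ j"
        using s s' that by (auto simp: fibre_def)
      then have "dot k (T j) r = (1 - u) * (y j - p $ j) + u * (y j - p $ j)" by (simp only: dr)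
      then show ?thesis by (simp add: algebra_simps)
    qed
    moreover have "t = p $ l + dot k (T l) r"
    proof -
      have "p $ l + dot k (T l) r = a + u * (b - a)"
        by (simp add: dr a_def b_def algebra_simps)
      also have "\<dots> = t" using ab by (simp add: u_def)
      finally show ?thesis by simp
    qed
    ultimately show "t \<in> fibre_image l p k J T y"
      by (auto simp: fibre_image_def fibre_def)
  qed
  then have "emeasure lborel {a..b} \<le> emeasure lborel (fibre_image l p k J T y)"
    by (intro emeasure_mono) auto
  then show ?thesis using ab by (simp add: a_def b_def)
next
  case False
  then show ?thesis by (simp add: ennreal_neg)
qed

lemma fibre_image_le:
  fixes T :: "'n::finite \<Rightarrow> nat \<Rightarrow> real"
  assumes "\<And>s. s \<in> fibre p k J T y \<Longrightarrow> a \<le> dot k (T l) s \<and> dot k (T l) s \<le> b"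
    and "a \<le> b"
  shows "emeasure lborel (fibre_image l p k J T y) \<le> ennreal (b - a)"
proof -
  have "emeasure lborel (fibre_image l p k J T y) \<le> emeasure lborel {p $ l + a..p $ l + b}"
    using assms by (intro emeasure_mono) (auto simp: fibre_image_def)
  then show ?thesis using assms by simp
qed

lemma fibre_update:
  assumes "l \<notin> J"
  shows "fibre p k J (T(l := R)) = fibre p k J T"
  using assms by (fastforce simp: fibre_def fun_eq_iff)

section \<open>Subadditivity and superadditivity of the volume in one row\<close>

lemma dot_combination:
  assumes "\<And>i. i < k \<Longrightarrow> R i = c * h i + (\<Sum>\<kappa>\<in>K. t \<kappa> * \<rho> \<kappa> i)"
  shows "dot k R s = c * dot k h s + (\<Sum>\<kappa>\<in>K. t \<kappa> * dot k (\<rho> \<kappa>) s)"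
proof -
  have "dot k R s = (\<Sum>i<k. c * (h i * s i) + (\<Sum>\<kappa>\<in>K. t \<kappa> * (\<rho> \<kappa> i * s i)))"
    unfolding dot_def by (intro sum.cong refl) (simp add: assms algebra_simps sum_distrib_left)
  also have "\<dots> = c * dot k h s + (\<Sum>i<k. \<Sum>\<kappa>\<in>K. t \<kappa> * (\<rho> \<kappa> i * s i))"
    by (simp add: dot_def sum.distrib sum_distrib_left)
  also have "(\<Sum>i<k. \<Sum>\<kappa>\<in>K. t \<kappa> * (\<rho> \<kappa> i * s i)) = (\<Sum>\<kappa>\<in>K. t \<kappa> * dot k (\<rho> \<kappa>) s)"
    by (subst sum.swap) (simp add: dot_def sum_distrib_left)
  finally show ?thesis .
qed

lemma nn_integral_sum_fibre_image:
  fixes T :: "'n::finite \<Rightarrow> nat \<Rightarrow> real"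
  assumes "l \<notin> J"
  shows "(\<Sum>\<kappa>\<in>K. ennreal (t \<kappa>) * coord_emeasure (insert l J) (zono p k (T(l := \<rho> \<kappa>))))
    = (\<integral>\<^sup>+y. (\<Sum>\<kappa>\<in>K. ennreal (t \<kappa>) * emeasure lborel (fibre_image l p k J (T(l := \<rho> \<kappa>)) y))
        \<partial>(\<Pi>\<^sub>M i\<in>J. lborel))"
proof -
  note [measurable] = measurable_emeasure_fibre_image[OF assms]
  show ?thesis
    by (subst nn_integral_sum) (auto simp: coord_emeasure_insert[OF assms] nn_integral_cmult)
qed

text \<open>Slice by slice, the width of \<open>R\<close> is attained at two points of the slice,
  and between these points each \<open>\<rho> \<kappa>\<close> varies by at most its own
  width.\<close>

lemma coord_emeasure_subadditive:
  fixes T :: "'n::finite \<Rightarrow> nat \<Rightarrow> real"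
  assumes l: "l \<notin> J" and d: "d \<in> J" and K: "finite K"
    and t: "\<And>\<kappa>. \<kappa> \<in> K \<Longrightarrow> 0 \<le> t \<kappa>"
    and R: "\<And>i. i < k \<Longrightarrow> R i = c * T d i + (\<Sum>\<kappa>\<in>K. t \<kappa> * \<rho> \<kappa> i)"
  shows "coord_emeasure (insert l J) (zono p k (T(l := R)))
    \<le> (\<Sum>\<kappa>\<in>K. ennreal (t \<kappa>) * coord_emeasure (insert l J) (zono p k (T(l := \<rho> \<kappa>))))"
  unfolding nn_integral_sum_fibre_image[OF l] unfolding coord_emeasure_insert[OF l]
proof (rule nn_integral_mono)
  fix y
  let ?F = "fibre_image l p k J (T(l := R)) y"
  show "emeasure lborel ?F
    \<le> (\<Sum>\<kappa>\<in>K. ennreal (t \<kappa>) * emeasure lborel (fibre_image l p k J (T(l := \<rho> \<kappa>)) y))"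
  proof (cases "fibre p k J T y = {}")
    case True
    then show ?thesis by (simp add: fibre_image_def fibre_update[OF l])
  next
    case False
    then have ne: "?F \<noteq> {}" by (simp add: fibre_image_def fibre_update[OF l])
    obtain s0 where s0: "s0 \<in> fibre p k J T y"
      and min: "\<And>s. s \<in> fibre p k J T y \<Longrightarrow> dot k R s0 \<le> dot k R s"
      using compact_attains_inf[OF compact_fibre_image ne]
      by (auto simp: fibre_image_def fibre_update[OF l])
    obtain s1 where s1: "s1 \<in> fibre p k J T y"
      and max: "\<And>s. s \<in> fibre p k J T y \<Longrightarrow> dot k R s \<le> dot k R s1"
      using compact_attains_sup[OF compact_fibre_image ne]
      by (auto simp: fibre_image_def fibre_update[OF l])
    \<comment> \<open>Since \<open>d\<close> belongs to \<open>J\<close>, the slice fixes the value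
      of row \<open>d\<close>; the summand \<open>c * T d i\<close> therefore contributes nothing to
      the width.\<close>
    have eqd: "dot k (T d) s0 = dot k (T d) s1"
    proof -
      have "y d = p $ d + dot k (T d) s0" "y d = p $ d + dot k (T d) s1"
        using s0 s1 d by (auto simp: fibre_def)
      then show ?thesis by simp
    qed
    have "emeasure lborel ?F \<le> ennreal (dot k R s1 - dot k R s0)"
      using min max s0 by (intro fibre_image_le) (auto simp: fibre_update[OF l])
    also have "dot k R s1 - dot k R s0 = (\<Sum>\<kappa>\<in>K. t \<kappa> * (dot k (\<rho> \<kappa>) s1 - dot k (\<rho> \<kappa>) s0))"
      by (simp add: dot_combination[where h="T d", OF R] eqd algebra_simps sum_subtractf)
    \<comment> \<open>The points are extremal for \<open>R\<close> only, so a single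
      \<open>\<rho> \<kappa>\<close> may decrease from \<open>s0\<close> to \<open>s1\<close>; such
      a term is bounded by 0.\<close>
    also have "ennreal \<dots> \<le> (\<Sum>\<kappa>\<in>K. ennreal (t \<kappa> * max 0 (dot k (\<rho> \<kappa>) s1 - dot k (\<rho> \<kappa>) s0)))"
      using t by (subst sum_ennreal) (auto intro!: ennreal_leI sum_mono mult_left_mono)
    also have "\<dots> \<le> (\<Sum>\<kappa>\<in>K. ennreal (t \<kappa>) * emeasure lborel (fibre_image l p k J (T(l := \<rho> \<kappa>)) y))"
    proof (rule sum_mono)
      fix \<kappa> assume "\<kappa> \<in> K"
      have "ennreal (max 0 (dot k (\<rho> \<kappa>) s1 - dot k (\<rho> \<kappa>) s0))
          \<le> emeasure lborel (fibre_image l p k J (T(l := \<rho> \<kappa>)) y)"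
        using fibre_image_ge[of s0 p k J "T(l := \<rho> \<kappa>)" y s1 l] s0 s1
        by (auto simp: fibre_update[OF l] max_def)
      then show "ennreal (t \<kappa> * max 0 (dot k (\<rho> \<kappa>) s1 - dot k (\<rho> \<kappa>) s0))
        \<le> ennreal (t \<kappa>) * emeasure lborel (fibre_image l p k J (T(l := \<rho> \<kappa>)) y)"
        using t[OF \<open>\<kappa> \<in> K\<close>] by (subst ennreal_mult) (auto intro!: mult_left_mono)
    qed
    finally show ?thesis .
  qed
qed

text \<open>By \<open>opt\<close>, one pair of points minimises and maximises all the pieces at
  once. The widths of the pieces then add up to the variation of \<open>R\<close> between these two
  points, which its width dominates.\<close>

lemma coord_emeasure_superadditive:
  fixes T :: "'n::finite \<Rightarrow> nat \<Rightarrow> real"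
  assumes l: "l \<notin> J" and d: "d \<in> J" and K: "finite K"
    and t: "\<And>\<kappa>. \<kappa> \<in> K \<Longrightarrow> 0 \<le> t \<kappa>"
    and R: "\<And>i. i < k \<Longrightarrow> R i = c * T d i + (\<Sum>\<kappa>\<in>K. t \<kappa> * \<rho> \<kappa> i)"
    and opt: "\<And>y. fibre p k J T y \<noteq> {} \<Longrightarrow> \<exists>s0\<in>fibre p k J T y. \<exists>s1\<in>fibre p k J T y.
      \<forall>\<kappa>\<in>K. \<forall>s\<in>fibre p k J T y. dot k (\<rho> \<kappa>) s0 \<le> dot k (\<rho> \<kappa>) s \<and> dot k (\<rho> \<kappa>) s \<le> dot k (\<rho> \<kappa>) s1"
  shows "(\<Sum>\<kappa>\<in>K. ennreal (t \<kappa>) * coord_emeasure (insert l J) (zono p k (T(l := \<rho> \<kappa>))))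
    \<le> coord_emeasure (insert l J) (zono p k (T(l := R)))"
  unfolding nn_integral_sum_fibre_image[OF l] unfolding coord_emeasure_insert[OF l]
proof (rule nn_integral_mono)
  fix y
  show "(\<Sum>\<kappa>\<in>K. ennreal (t \<kappa>) * emeasure lborel (fibre_image l p k J (T(l := \<rho> \<kappa>)) y))
    \<le> emeasure lborel (fibre_image l p k J (T(l := R)) y)"
  proof (cases "fibre p k J T y = {}")
    case True
    then show ?thesis by (simp add: fibre_image_def fibre_update[OF l])
  next
    case False
    then obtain s0 s1 where s0: "s0 \<in> fibre p k J T y" and s1: "s1 \<in> fibre p k J T y"
      and bd: "\<And>\<kappa> s. \<kappa> \<in> K \<Longrightarrow> s \<in> fibre p k J T y \<Longrightarrow>
        dot k (\<rho> \<kappa>) s0 \<le> dot k (\<rho> \<kappa>) s \<and> dot k (\<rho> \<kappa>) s \<le> dot k (\<rho> \<kappa>) s1"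
      using opt by blast
    have eqd: "dot k (T d) s0 = dot k (T d) s1"
    proof -
      have "y d = p $ d + dot k (T d) s0" "y d = p $ d + dot k (T d) s1"
        using s0 s1 d by (auto simp: fibre_def)
      then show ?thesis by simp
    qed
    have "(\<Sum>\<kappa>\<in>K. ennreal (t \<kappa>) * emeasure lborel (fibre_image l p k J (T(l := \<rho> \<kappa>)) y))
        \<le> (\<Sum>\<kappa>\<in>K. ennreal (t \<kappa>) * ennreal (dot k (\<rho> \<kappa>) s1 - dot k (\<rho> \<kappa>) s0))"
    proof (intro sum_mono mult_left_mono)
      fix \<kappa> assume "\<kappa> \<in> K"
      then show "emeasure lborel (fibre_image l p k J (T(l := \<rho> \<kappa>)) y)
          \<le> ennreal (dot k (\<rho> \<kappa>) s1 - dot k (\<rho> \<kappa>) s0)"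
        using bd s0 by (intro fibre_image_le) (auto simp: fibre_update[OF l])
    qed simp
    also have "\<dots> = (\<Sum>\<kappa>\<in>K. ennreal (t \<kappa> * (dot k (\<rho> \<kappa>) s1 - dot k (\<rho> \<kappa>) s0)))"
      using t bd s0 by (intro sum.cong refl) (simp add: ennreal_mult)
    also have "\<dots> = ennreal (\<Sum>\<kappa>\<in>K. t \<kappa> * (dot k (\<rho> \<kappa>) s1 - dot k (\<rho> \<kappa>) s0))"
      using t bd s0 by (intro sum_ennreal) (simp add: mult_nonneg_nonneg)
    also have "(\<Sum>\<kappa>\<in>K. t \<kappa> * (dot k (\<rho> \<kappa>) s1 - dot k (\<rho> \<kappa>) s0)) = dot k R s1 - dot k R s0"
      by (simp add: dot_combination[where h="T d", OF R] eqd algebra_simps sum_subtractf)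
    also have "ennreal \<dots> \<le> emeasure lborel (fibre_image l p k J (T(l := R)) y)"
      using fibre_image_ge[of s0 p k J "T(l := R)" y s1 l] s0 s1 by (simp add: fibre_update[OF l])
    finally show ?thesis .
  qed
qed

section \<open>The fractional knapsack problem and the splitting of a row\<close>

section \<open>Greedy optimisation on slices of the cube\<close>

text \<open>A telescoping sum: \<open>c\<close> is the smallest element of \<open>V\<close>, where
  \<open>t\<close> is 0, and elsewhere \<open>t v\<close> is the gap between \<open>v\<close> and
  its predecessor. Induction adds elements in increasing order.\<close>

lemma step_decomposition:
  fixes V :: "real set"
  assumes "finite V"
  shows "\<exists>c t. (\<forall>v. 0 \<le> t v) \<and> (\<forall>x\<in>V. x = c + (\<Sum>v\<in>V. if v \<le> x then t v else 0))"
  using assms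
proof (induction rule: finite_linorder_max_induct)
  case (insert b V)
  then obtain c t where t: "\<And>v. 0 \<le> t v"
    and eq: "\<And>x. x \<in> V \<Longrightarrow> x = c + (\<Sum>v\<in>V. if v \<le> x then t v else 0)"
    by blast
  show ?case
  proof (cases "V = {}")
    case True
    then show ?thesis by (intro exI[of _ b] exI[of _ "\<lambda>_. 0"]) simp
  next
    case False
    \<comment> \<open>The new maximum receives its gap to the old one; the sums for smaller elements
      do not see it.\<close>
    define t' where "t' = t(b := b - Max V)"
    have bV: "b \<notin> V" using insert.hyps(2) by blast
    have "Max V < b" using insert.hyps False by simp
    then have "\<forall>v. 0 \<le> t' v" using t by (simp add: t'_def)
    moreover have "x = c + (\<Sum>v\<in>insert b V. if v \<le> x then t' v else 0)" if "x \<in> insert b V" for x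
    proof -
      have sumV: "(\<Sum>v\<in>V. if v \<le> z then t' v else 0) = (\<Sum>v\<in>V. if v \<le> z then t v else 0)" for z
        using bV by (intro sum.cong) (auto simp: t'_def)
      show ?thesis
      proof (cases "x = b")
        case True
        have "(\<Sum>v\<in>V. if v \<le> b then t v else 0) = (\<Sum>v\<in>V. if v \<le> Max V then t v else 0)"
          using insert.hyps by (intro sum.cong) (auto simp: less_imp_le)
        also have "\<dots> = Max V - c" using eq[OF Max_in[OF insert.hyps(1) False]] by linarith
        finally have "(\<Sum>v\<in>V. if v \<le> b then t v else 0) = Max V - c" .
        then show ?thesis using True bV insert.hyps(1) sumV[of b] by (simp add: t'_def)
      next
        case False
        then have "x \<in> V" using that by simp
        then have "\<not> b \<le> x" using insert.hyps(2) by (simp add: not_le)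
        then show ?thesis using eq[OF \<open>x \<in> V\<close>] sumV[of x] bV insert.hyps(1) by simp
      qed
    qed
    ultimately show ?thesis by blast
  qed
qed auto

lemma dot_diff_one: "dot k r (\<lambda>i. 1 - s i) = (\<Sum>i<k. r i) - dot k r s"
  by (simp add: dot_def algebra_simps sum_subtractf)

lemma unit_cube_diff_one: "(\<lambda>i. 1 - s i) \<in> unit_cube \<longleftrightarrow> s \<in> unit_cube"
  by (auto simp: unit_cube_def)

text \<open>Fill the coordinates in order of decreasing \<open>x\<close> until the budget
  \<open>dot k h s0\<close> is spent. The filling does not depend on \<open>v\<close>, so it is
  optimal for all superlevel sets together. Coordinates with \<open>h j = 0\<close> cost nothing and
  are set by the sign of \<open>R j\<close>.\<close>

lemma exists_greedy_maximiser:
  fixes x R h :: "nat \<Rightarrow> real"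
  assumes h: "\<And>i. i < k \<Longrightarrow> 0 \<le> h i" and s0: "s0 \<in> unit_cube"
  shows "\<exists>s1\<in>unit_cube. dot k h s1 = dot k h s0 \<and>
    (\<forall>v. \<forall>s\<in>unit_cube. dot k h s = dot k h s0 \<longrightarrow>
       dot k (\<lambda>i. if v \<le> x i then h i else 0) s \<le> dot k (\<lambda>i. if v \<le> x i then h i else 0) s1) \<and>
    (\<forall>j<k. h j = 0 \<longrightarrow> s1 j = (if 0 \<le> R j then 1 else 0))"
proof -
  \<comment> \<open>\<open>g P\<close> is the capacity of the coordinates selected by
    \<open>P\<close>, that is, the amount of budget they can absorb.\<close>
  define g where "g = (\<lambda>P. \<Sum>i<k. if P i then h i else 0)"
  define y where "y = dot k h s0"
  have sc: "0 \<le> s i" "s i \<le> 1" if "s \<in> unit_cube" for s :: "nat \<Rightarrow> real" and i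
    using that by (auto simp: unit_cube_def)
  have y0: "0 \<le> y" unfolding y_def dot_def using h sc[OF s0] by (intro sum_nonneg) auto
  have dot_le_g: "dot k (\<lambda>i. if P i then h i else 0) s \<le> g P" if "s \<in> unit_cube" for s P
    unfolding dot_def g_def using h sc[OF that] by (intro sum_mono) (auto simp: mult_left_le)
  have dot_le: "dot k (\<lambda>i. if P i then h i else 0) s \<le> dot k h s" if "s \<in> unit_cube" for s P
    unfolding dot_def using h sc[OF that] by (intro sum_mono) auto
  define A where "A = {i. i < k \<and> 0 < h i}"
  have finA: "finite A" by (simp add: A_def)
  have nA: "h i = 0" if "i < k" "i \<notin> A" for i using h[OF that(1)] that by (auto simp: A_def)
  have gcong: "g P = g Q" if "\<And>i. i \<in> A \<Longrightarrow> P i = Q i" for P Q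
    unfolding g_def using that nA by (intro sum.cong refl) (metis (full_types) lessThan_iff)
  \<comment> \<open>The threshold of the greedy filling: the budget covers everything strictly above
    \<open>\<tau>\<close>, and it can be spent at or above \<open>\<tau>\<close>.\<close>
  have "\<exists>\<tau>. g (\<lambda>i. \<tau> < x i) \<le> y \<and> y \<le> g (\<lambda>i. \<tau> \<le> x i)"
  proof (cases "A = {}")
    case True
    have "g P = 0" for P using gcong[of P "\<lambda>_. False"] True by (simp add: g_def)
    moreover have "y = 0" using nA True by (simp add: y_def dot_def)
    ultimately show ?thesis by simp
  next
    case False
    define W where "W = {v \<in> x ` A. y \<le> g (\<lambda>i. v \<le> x i)}"
    have finW: "finite W" using finA by (simp add: W_def)
    have "y \<le> g (\<lambda>_. True)" using dot_le_g[OF s0, of "\<lambda>_. True"] by (simp add: y_def)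
    also have "g (\<lambda>_. True) = g (\<lambda>i. Min (x ` A) \<le> x i)" using finA by (intro gcong) simp
    finally have "Min (x ` A) \<in> W" using finA False by (simp add: W_def)
    then have "Max W \<in> W" using finW by (intro Max_in) auto
    moreover have "g (\<lambda>i. Max W < x i) \<le> y"
    proof (rule ccontr)
      \<comment> \<open>Otherwise the least ratio above \<open>Max W\<close> has a superlevel set
        whose capacity still exceeds the budget, so it too lies in \<open>W\<close>.\<close>
      assume neg: "\<not> g (\<lambda>i. Max W < x i) \<le> y"
      define U where "U = {i \<in> A. Max W < x i}"
      have "U \<noteq> {}"
      proof
        assume "U = {}"
        then have "g (\<lambda>i. Max W < x i) = g (\<lambda>_. False)" by (intro gcong) (auto simp: U_def)
        then show False using neg y0 by (simp add: g_def)
      qed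
      then have m: "Min (x ` U) \<in> x ` U" using finA by (intro Min_in) (auto simp: U_def)
      then have gt: "Max W < Min (x ` U)" by (auto simp: U_def)
      have "g (\<lambda>i. Min (x ` U) \<le> x i) = g (\<lambda>i. Max W < x i)"
        using finA gt by (intro gcong) (auto simp: U_def intro!: Min_le)
      then have "Min (x ` U) \<in> W" using neg m by (auto simp: W_def U_def)
      then show False using gt finW by (meson Max_ge not_le)
    qed
    ultimately show ?thesis by (auto simp: W_def)
  qed
  then obtain \<tau> where lo: "g (\<lambda>i. \<tau> < x i) \<le> y" and hi: "y \<le> g (\<lambda>i. \<tau> \<le> x i)" by blast
  have split: "g (\<lambda>i. \<tau> \<le> x i) = g (\<lambda>i. \<tau> < x i) + g (\<lambda>i. \<tau> = x i)"
    unfolding g_def by (subst sum.distrib[symmetric]) (auto intro!: sum.cong)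
  \<comment> \<open>The common fraction to which all coordinates at the threshold are filled; when
    these have no capacity, 0 will do.\<close>
  obtain \<theta> where \<theta>: "0 \<le> \<theta>" "\<theta> \<le> 1" "y = g (\<lambda>i. \<tau> < x i) + \<theta> * g (\<lambda>i. \<tau> = x i)"
  proof (cases "g (\<lambda>i. \<tau> = x i) = 0")
    case True
    then show ?thesis using that[of 0] lo hi split by simp
  next
    case False
    then have "0 < g (\<lambda>i. \<tau> = x i)" using lo hi split by simp
    then show ?thesis using that[of "(y - g (\<lambda>i. \<tau> < x i)) / g (\<lambda>i. \<tau> = x i)"] lo hi split
      by (simp add: field_simps)
  qed
  define s1 where "s1 = (\<lambda>j. if j < k \<and> h j = 0 then if 0 \<le> R j then 1 else 0
    else if \<tau> < x j then 1 else if \<tau> = x j then \<theta> else 0)"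
  have "s1 \<in> unit_cube" using \<theta> by (auto simp: unit_cube_def s1_def)
  have "dot k h s1 = (\<Sum>i<k. (if \<tau> < x i then h i else 0) + \<theta> * (if \<tau> = x i then h i else 0))"
    unfolding dot_def by (intro sum.cong) (auto simp: s1_def)
  also have "\<dots> = y" by (simp add: \<theta>(3) g_def sum.distrib sum_distrib_left)
  finally have s1y: "dot k h s1 = y" .
  show ?thesis
  proof (intro bexI[OF _ \<open>s1 \<in> unit_cube\<close>] conjI allI ballI impI)
    show "dot k h s1 = dot k h s0" using s1y by (simp add: y_def)
    show "s1 j = (if 0 \<le> R j then 1 else 0)" if "j < k" "h j = 0" for j
      using that by (simp add: s1_def)
    fix v s assume s: "s \<in> unit_cube" "dot k h s = dot k h s0"
    show "dot k (\<lambda>i. if v \<le> x i then h i else 0) s \<le> dot k (\<lambda>i. if v \<le> x i then h i else 0) s1"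
    proof (cases "\<tau> < v")
      case True
      \<comment> \<open>Above the threshold the superlevel set is filled completely, so its capacity
        is attained.\<close>
      have "g (\<lambda>i. v \<le> x i) = dot k (\<lambda>i. if v \<le> x i then h i else 0) s1"
        unfolding dot_def g_def using True by (intro sum.cong) (auto simp: s1_def)
      then show ?thesis using dot_le_g[OF s(1)] by metis
    next
      case False
      \<comment> \<open>Here the superlevel set contains every paid coordinate that
        \<open>s1\<close> uses, so the entire budget is spent inside it.\<close>
      have "dot k h s1 = dot k (\<lambda>i. if v \<le> x i then h i else 0) s1"
        unfolding dot_def using False by (intro sum.cong) (auto simp: s1_def)
      then show ?thesis using dot_le[OF s(1), of "\<lambda>i. v \<le> x i"] s(2) s1y by (simp add: y_def)
    qed
  qed
qed

text \<open>The two shapes of pieces: superlevel sets of the ratio to \<open>h\<close> give the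
  first, and single indices where that ratio has no meaning give the second.\<close>

definition basic_row :: "nat \<Rightarrow> (nat \<Rightarrow> real) \<Rightarrow> (nat \<Rightarrow> real) \<Rightarrow> bool" where
  "basic_row k h \<rho> \<longleftrightarrow> (\<exists>S. \<forall>i<k. \<rho> i = (if i \<in> S then h i else 0)) \<or>
     (\<exists>j<k. h j = 0 \<and> (\<forall>i<k. i \<noteq> j \<longrightarrow> \<rho> i = 0))"

text \<open>Where \<open>h\<close> is positive, \<open>step_decomposition\<close> writes the ratio
  \<open>R i / h i\<close> as a constant plus a nonnegative combination of indicators of superlevel
  sets; multiplication by \<open>h\<close> gives the left summands of \<open>K\<close>. Each index
  with \<open>h\<close> zero gives a right summand. The greedy filling optimises all of them at
  once.\<close>

lemma basic_row_decomposition: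
  fixes R h :: "nat \<Rightarrow> real"
  assumes h: "\<And>i. i < k \<Longrightarrow> 0 \<le> h i"
  obtains K :: "(real + nat) set" and c t \<rho> where
    "finite K" "\<And>\<kappa>. 0 \<le> t \<kappa>" "\<And>\<kappa>. \<kappa> \<in> K \<Longrightarrow> basic_row k h (\<rho> \<kappa>)"
    "\<And>i. i < k \<Longrightarrow> R i = c * h i + (\<Sum>\<kappa>\<in>K. t \<kappa> * \<rho> \<kappa> i)"
    "\<And>s. s \<in> unit_cube \<Longrightarrow> \<exists>s0 s1. s0 \<in> unit_cube \<and> s1 \<in> unit_cube \<and>
       dot k h s0 = dot k h s \<and> dot k h s1 = dot k h s \<and>
       (\<forall>\<kappa>\<in>K. \<forall>s'\<in>unit_cube. dot k h s' = dot k h s \<longrightarrow>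
          dot k (\<rho> \<kappa>) s0 \<le> dot k (\<rho> \<kappa>) s' \<and> dot k (\<rho> \<kappa>) s' \<le> dot k (\<rho> \<kappa>) s1)"
proof -
  define x where "x = (\<lambda>i. R i / h i)"
  define V where "V = x ` {i. i < k \<and> 0 < h i}"
  define N where "N = {i. i < k \<and> h i = 0}"
  have finV: "finite V" and finN: "finite N" by (auto simp: V_def N_def)
  obtain c \<tau> where \<tau>: "\<And>v. 0 \<le> \<tau> v"
    and x_eq: "\<And>z. z \<in> V \<Longrightarrow> z = c + (\<Sum>v\<in>V. if v \<le> z then \<tau> v else 0)"
    using step_decomposition[OF finV] by blast
  define K where "K = V <+> N"
  \<comment> \<open>Weights must be nonnegative, so an entry \<open>R j\<close> of either sign goes
    into the piece itself, which gets weight 1.\<close>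
  define t where "t = case_sum \<tau> (\<lambda>_ :: nat. 1)"
  define \<rho> where "\<rho> = case_sum (\<lambda>v i. if v \<le> x i then h i else 0) (\<lambda>j i. if i = j then R i else 0)"
  have max: "dot k (\<rho> \<kappa>) s' \<le> dot k (\<rho> \<kappa>) s1"
    if \<kappa>: "\<kappa> \<in> K" and s': "s' \<in> unit_cube" "dot k h s' = y"
      and s1: "\<forall>v. \<forall>s\<in>unit_cube. dot k h s = y \<longrightarrow>
       dot k (\<lambda>i. if v \<le> x i then h i else 0) s \<le> dot k (\<lambda>i. if v \<le> x i then h i else 0) s1"
      "\<forall>j<k. h j = 0 \<longrightarrow> s1 j = (if 0 \<le> R j then 1 else 0)"
    for \<kappa> s' s1 y
  proof (cases \<kappa>)
    case (Inl v)
    then show ?thesis using s1(1) s' by (simp add: \<rho>_def)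
  next
    case (Inr j)
    then have j: "j < k" "h j = 0" using \<kappa> by (auto simp: K_def N_def)
    have e: "dot k (\<rho> \<kappa>) z = R j * z j" for z
      using j by (simp add: Inr \<rho>_def dot_def if_distrib[where f="\<lambda>a. a * _"] cong: if_cong)
    have "0 \<le> s' j" "s' j \<le> 1" using s' by (auto simp: unit_cube_def)
    then show ?thesis using s1(2) j by (auto simp: e mult_left_le mult_nonpos_nonneg)
  qed
  show ?thesis
  proof (rule that[of K t \<rho> c])
    show "finite K" using finV finN by (simp add: K_def)
    show "0 \<le> t \<kappa>" for \<kappa> using \<tau> by (cases \<kappa>) (auto simp: t_def)
    show "basic_row k h (\<rho> \<kappa>)" if "\<kappa> \<in> K" for \<kappa>
    proof (cases \<kappa>)
      case (Inl v)
      then have "\<forall>i<k. \<rho> \<kappa> i = (if i \<in> {i. v \<le> x i} then h i else 0)" by (simp add: \<rho>_def)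
      then show ?thesis unfolding basic_row_def by blast
    next
      case (Inr j)
      then show ?thesis using that by (auto simp: basic_row_def K_def N_def \<rho>_def)
    qed
    show "R i = c * h i + (\<Sum>\<kappa>\<in>K. t \<kappa> * \<rho> \<kappa> i)" if i: "i < k" for i
    proof -
      have "(\<Sum>\<kappa>\<in>K. t \<kappa> * \<rho> \<kappa> i)
          = (\<Sum>v\<in>V. \<tau> v * (if v \<le> x i then h i else 0)) + (\<Sum>j\<in>N. if i = j then R i else 0)"
        unfolding K_def using finV finN by (simp add: sum.Plus t_def \<rho>_def)
      also have "(\<Sum>v\<in>V. \<tau> v * (if v \<le> x i then h i else 0))
          = (\<Sum>v\<in>V. if v \<le> x i then \<tau> v else 0) * h i"
        unfolding sum_distrib_right by (intro sum.cong) auto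
      also have "(\<Sum>j\<in>N. if i = j then R i else 0) = (if h i = 0 then R i else 0)"
        using finN i by (simp add: N_def)
      finally have eq: "(\<Sum>\<kappa>\<in>K. t \<kappa> * \<rho> \<kappa> i)
          = (\<Sum>v\<in>V. if v \<le> x i then \<tau> v else 0) * h i + (if h i = 0 then R i else 0)" .
      show ?thesis
      proof (cases "h i = 0")
        case False
        then have hi: "0 < h i" using h[OF i] by simp
        then have "x i = c + (\<Sum>v\<in>V. if v \<le> x i then \<tau> v else 0)" using i by (intro x_eq) (auto simp: V_def)
        then have "R i = (c + (\<Sum>v\<in>V. if v \<le> x i then \<tau> v else 0)) * h i"
          using hi by (simp add: x_def field_simps)
        then show ?thesis using False by (simp add: eq algebra_simps)
      qed (simp add: eq)
    qed
    fix s :: "nat \<Rightarrow> real" assume s: "s \<in> unit_cube"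
    obtain s1 where s1: "s1 \<in> unit_cube" "dot k h s1 = dot k h s"
      "\<forall>v. \<forall>s'\<in>unit_cube. dot k h s' = dot k h s \<longrightarrow>
       dot k (\<lambda>i. if v \<le> x i then h i else 0) s' \<le> dot k (\<lambda>i. if v \<le> x i then h i else 0) s1"
      "\<forall>j<k. h j = 0 \<longrightarrow> s1 j = (if 0 \<le> R j then 1 else 0)"
      using exists_greedy_maximiser[where R=R and x=x and k=k and h=h, OF _ s] h by blast
    \<comment> \<open>the reflection \<open>s \<mapsto> 1 - s\<close> of the cube exchanges minimisers and maximisers\<close>
    define r where "r = (\<lambda>i. 1 - s i)"
    have r: "r \<in> unit_cube" using s by (simp add: r_def unit_cube_diff_one)
    obtain r1 where r1: "r1 \<in> unit_cube" "dot k h r1 = dot k h r"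
      "\<forall>v. \<forall>s'\<in>unit_cube. dot k h s' = dot k h r \<longrightarrow>
       dot k (\<lambda>i. if v \<le> x i then h i else 0) s' \<le> dot k (\<lambda>i. if v \<le> x i then h i else 0) r1"
      "\<forall>j<k. h j = 0 \<longrightarrow> r1 j = (if 0 \<le> R j then 1 else 0)"
      using exists_greedy_maximiser[where R=R and x=x and k=k and h=h, OF _ r] h by blast
    define s0 where "s0 = (\<lambda>i. 1 - r1 i)"
    have "s0 \<in> unit_cube" using r1(1) by (simp add: s0_def unit_cube_diff_one)
    moreover have "dot k h s0 = dot k h s"
      using r1(2) by (simp add: s0_def r_def dot_diff_one)
    moreover have "dot k (\<rho> \<kappa>) s0 \<le> dot k (\<rho> \<kappa>) s'"
      if "\<kappa> \<in> K" "s' \<in> unit_cube" "dot k h s' = dot k h s" for \<kappa> s'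
    proof -
      have "dot k (\<rho> \<kappa>) (\<lambda>i. 1 - s' i) \<le> dot k (\<rho> \<kappa>) r1"
        using that(3) by (intro max[OF that(1) _ _ r1(3,4)])
          (auto simp: unit_cube_diff_one that(2) dot_diff_one r_def)
      then show ?thesis by (simp add: s0_def dot_diff_one)
    qed
    moreover have "dot k (\<rho> \<kappa>) s' \<le> dot k (\<rho> \<kappa>) s1"
      if "\<kappa> \<in> K" "s' \<in> unit_cube" "dot k h s' = dot k h s" for \<kappa> s'
      by (rule max[OF that s1(3,4)])
    ultimately show "\<exists>s0 s1. s0 \<in> unit_cube \<and> s1 \<in> unit_cube \<and>
       dot k h s0 = dot k h s \<and> dot k h s1 = dot k h s \<and>
       (\<forall>\<kappa>\<in>K. \<forall>s'\<in>unit_cube. dot k h s' = dot k h s \<longrightarrow>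
          dot k (\<rho> \<kappa>) s0 \<le> dot k (\<rho> \<kappa>) s' \<and> dot k (\<rho> \<kappa>) s' \<le> dot k (\<rho> \<kappa>) s1)"
      using s1(1,2) by blast
  qed
qed

section \<open>Replacing one row of the matrix by a basic row\<close>

section \<open>Reduction of the generators\<close>

text \<open>Consequently a change of row \<open>l\<close> affects, among the factors of the
  inequality, only the full volume and the area in the plane of \<open>l\<close> and
  \<open>d\<close>.\<close>

lemma coord_vol_zono_cong:
  assumes "\<And>l. l \<in> I \<Longrightarrow> T l = T' l"
  shows "coord_vol I (zono p k T) = coord_vol I (zono p k T')"
  using assms by (simp add: coord_vol_def zono_def image_image cong: restrict_cong)

lemma ennreal_coord_vol: "ennreal (coord_vol I (zono p k T)) = coord_emeasure I (zono p k T)"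
  using coord_emeasure_finite[OF compact_zono, of I p k T] by (simp add: coord_vol_eq)

lemma coord_vol_nonneg [simp]: "0 \<le> coord_vol I A"
  by (simp add: coord_vol_def)

lemma ennreal_sum_coord_vol:
  assumes "\<And>\<kappa>. \<kappa> \<in> K \<Longrightarrow> 0 \<le> t \<kappa>"
  shows "ennreal (\<Sum>\<kappa>\<in>K. t \<kappa> * coord_vol I (zono p k (Z \<kappa>)))
    = (\<Sum>\<kappa>\<in>K. ennreal (t \<kappa>) * coord_emeasure I (zono p k (Z \<kappa>)))"
  using assms by (subst sum_ennreal[symmetric]) (auto simp: ennreal_mult ennreal_coord_vol)

lemma zonotope_ineq_zono:
  "zonotope_ineq d (zono p k T) \<longleftrightarrow>
     coord_vol UNIV (zono p k T) * coord_vol {d} (zono p k T) ^ (CARD('n) - 2)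
       \<le> (\<Prod>l\<in>UNIV - {d :: 'n::finite}. coord_vol {l, d} (zono p k T))"
  by (simp add: zonotope_ineq_def coord_vol_coord_proj measure_lebesgue_eq_coord_vol[OF compact_zono])

text \<open>The left side is subadditive and the right side superadditive under the decomposition of
  row \<open>l\<close>, while all other factors stay fixed. So the inequalities for the pieces,
  added with weights \<open>t\<close>, give the one for \<open>T\<close>.\<close>

lemma zonotope_ineq_of_basic_row:
  fixes T :: "'n::finite \<Rightarrow> nat \<Rightarrow> real"
  assumes ld: "l \<noteq> d" and h: "\<And>i. i < k \<Longrightarrow> 0 \<le> T d i"
    and basic: "\<And>\<rho>. basic_row k (T d) \<rho> \<Longrightarrow> zonotope_ineq d (zono p k (T(l := \<rho>)))"
  shows "zonotope_ineq d (zono p k T)"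
proof (rule basic_row_decomposition[where R="T l" and h="T d" and k=k])
  show "0 \<le> T d i" if "i < k" for i using that by (rule h)
next
  fix K :: "(real + nat) set" and c t \<rho>
  assume K: "finite K" and t: "\<And>\<kappa>. 0 \<le> t \<kappa>"
    and b: "\<And>\<kappa>. \<kappa> \<in> K \<Longrightarrow> basic_row k (T d) (\<rho> \<kappa>)"
    and R: "\<And>i. i < k \<Longrightarrow> T l i = c * T d i + (\<Sum>\<kappa>\<in>K. t \<kappa> * \<rho> \<kappa> i)"
    and opt: "\<And>s. s \<in> unit_cube \<Longrightarrow> \<exists>s0 s1. s0 \<in> unit_cube \<and> s1 \<in> unit_cube \<and>
       dot k (T d) s0 = dot k (T d) s \<and> dot k (T d) s1 = dot k (T d) s \<and>
       (\<forall>\<kappa>\<in>K. \<forall>s'\<in>unit_cube. dot k (T d) s' = dot k (T d) s \<longrightarrow>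
          dot k (\<rho> \<kappa>) s0 \<le> dot k (\<rho> \<kappa>) s' \<and> dot k (\<rho> \<kappa>) s' \<le> dot k (\<rho> \<kappa>) s1)"
  define Z where "Z = (\<lambda>\<kappa>. T(l := \<rho> \<kappa>))"
  have "coord_emeasure (insert l (UNIV - {l})) (zono p k (T(l := T l)))
    \<le> (\<Sum>\<kappa>\<in>K. ennreal (t \<kappa>) * coord_emeasure (insert l (UNIV - {l})) (zono p k (T(l := \<rho> \<kappa>))))"
    using ld K t R by (intro coord_emeasure_subadditive[where d=d]) auto
  then have "ennreal (coord_vol UNIV (zono p k T)) \<le> ennreal (\<Sum>\<kappa>\<in>K. t \<kappa> * coord_vol UNIV (zono p k (Z \<kappa>)))"
    using t by (simp add: ennreal_sum_coord_vol ennreal_coord_vol Z_def insert_absorb)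
  then have sub: "coord_vol UNIV (zono p k T) \<le> (\<Sum>\<kappa>\<in>K. t \<kappa> * coord_vol UNIV (zono p k (Z \<kappa>)))"
    using t by (subst (asm) ennreal_le_iff) (auto intro!: sum_nonneg)
  have "(\<Sum>\<kappa>\<in>K. ennreal (t \<kappa>) * coord_emeasure (insert l {d}) (zono p k (T(l := \<rho> \<kappa>))))
    \<le> coord_emeasure (insert l {d}) (zono p k (T(l := T l)))"
  proof (rule coord_emeasure_superadditive[where d=d])
    fix y assume "fibre p k {d} T y \<noteq> {}"
    then obtain s where s: "s \<in> unit_cube" "y d = p $ d + dot k (T d) s"
      by (auto simp: fibre_def)
    \<comment> \<open>In the plane a slice has the single constraint given by row \<open>d\<close>,
      which is exactly the situation where the pieces have a common optimum.\<close>
    then have "fibre p k {d} T y = {s' \<in> unit_cube. dot k (T d) s' = dot k (T d) s}"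
      by (auto simp: fibre_def)
    then show "\<exists>s0\<in>fibre p k {d} T y. \<exists>s1\<in>fibre p k {d} T y.
      \<forall>\<kappa>\<in>K. \<forall>s\<in>fibre p k {d} T y. dot k (\<rho> \<kappa>) s0 \<le> dot k (\<rho> \<kappa>) s \<and> dot k (\<rho> \<kappa>) s \<le> dot k (\<rho> \<kappa>) s1"
      using opt[OF s(1)] by fastforce
  qed (use ld K t R in auto)
  then have "ennreal (\<Sum>\<kappa>\<in>K. t \<kappa> * coord_vol {l, d} (zono p k (Z \<kappa>))) \<le> ennreal (coord_vol {l, d} (zono p k T))"
    using t by (simp add: ennreal_sum_coord_vol ennreal_coord_vol Z_def)
  then have super: "(\<Sum>\<kappa>\<in>K. t \<kappa> * coord_vol {l, d} (zono p k (Z \<kappa>))) \<le> coord_vol {l, d} (zono p k T)"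
    by simp
  define w where "w = coord_vol {d} (zono p k T) ^ (CARD('n) - 2)"
  define q where "q = (\<Prod>j\<in>UNIV - {d} - {l}. coord_vol {j, d} (zono p k T))"
  have w0: "0 \<le> w" and q0: "0 \<le> q" by (auto simp: w_def q_def intro!: prod_nonneg)
  \<comment> \<open>\<open>w\<close> and \<open>q\<close> collect the factors that do not involve
    row \<open>l\<close>, so they are the same for every piece.\<close>
  have Z_le: "coord_vol UNIV (zono p k (Z \<kappa>)) * w \<le> coord_vol {l, d} (zono p k (Z \<kappa>)) * q"
    if "\<kappa> \<in> K" for \<kappa>
  proof -
    have "coord_vol {d} (zono p k (Z \<kappa>)) = coord_vol {d} (zono p k T)"
      using ld by (intro coord_vol_zono_cong) (auto simp: Z_def)
    moreover have "(\<Prod>j\<in>UNIV - {d}. coord_vol {j, d} (zono p k (Z \<kappa>)))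
        = coord_vol {l, d} (zono p k (Z \<kappa>)) * (\<Prod>j\<in>UNIV - {d} - {l}. coord_vol {j, d} (zono p k (Z \<kappa>)))"
      using ld by (intro prod.remove) auto
    moreover have "(\<Prod>j\<in>UNIV - {d} - {l}. coord_vol {j, d} (zono p k (Z \<kappa>))) = q"
      unfolding q_def using ld by (intro prod.cong refl coord_vol_zono_cong) (auto simp: Z_def)
    ultimately show ?thesis
      using basic[OF b[OF that]] unfolding zonotope_ineq_zono by (simp add: w_def Z_def)
  qed
  have "coord_vol UNIV (zono p k T) * w \<le> (\<Sum>\<kappa>\<in>K. t \<kappa> * coord_vol UNIV (zono p k (Z \<kappa>))) * w"
    using sub w0 by (rule mult_right_mono)
  also have "\<dots> = (\<Sum>\<kappa>\<in>K. t \<kappa> * (coord_vol UNIV (zono p k (Z \<kappa>)) * w))"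
    by (simp add: sum_distrib_right mult.assoc)
  also have "\<dots> \<le> (\<Sum>\<kappa>\<in>K. t \<kappa> * (coord_vol {l, d} (zono p k (Z \<kappa>)) * q))"
    using t Z_le by (intro sum_mono mult_left_mono) auto
  also have "\<dots> = (\<Sum>\<kappa>\<in>K. t \<kappa> * coord_vol {l, d} (zono p k (Z \<kappa>))) * q"
    by (simp add: sum_distrib_right mult.assoc)
  also have "\<dots> \<le> coord_vol {l, d} (zono p k T) * q"
    using super q0 by (rule mult_right_mono)
  also have "\<dots> = (\<Prod>j\<in>UNIV - {d}. coord_vol {j, d} (zono p k T))"
    unfolding q_def using ld by (intro prod.remove[symmetric]) auto
  finally show ?thesis unfolding zonotope_ineq_zono by (simp add: w_def)
qed

section \<open>Merging parallel generators and counting supports\<close>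

lemma closed_segment_scaleR_add:
  fixes w :: "'a::real_normed_vector"
  assumes "0 \<le> a" "0 \<le> b"
  shows "closed_segment 0 (a *\<^sub>R w) + closed_segment 0 (b *\<^sub>R w) = closed_segment 0 ((a + b) *\<^sub>R w)"
proof (intro equalityI subsetI)
  fix x assume "x \<in> closed_segment 0 (a *\<^sub>R w) + closed_segment 0 (b *\<^sub>R w)"
  then obtain u v where uv: "0 \<le> u" "u \<le> 1" "0 \<le> v" "v \<le> 1" and x: "x = (u * a + v * b) *\<^sub>R w"
    by (auto simp: in_segment scaleR_add_left elim!: set_plus_elim)
  show "x \<in> closed_segment 0 ((a + b) *\<^sub>R w)"
  proof (cases "a + b = 0")
    case True
    then show ?thesis using assms x by (auto simp: add_nonneg_eq_0_iff)
  next
    case False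
    then have pos: "0 < a + b" using assms by simp
    have "u * a + v * b \<le> 1 * a + 1 * b" using assms uv by (intro add_mono mult_right_mono) auto
    then have "(u * a + v * b) / (a + b) \<le> 1" "0 \<le> (u * a + v * b) / (a + b)"
      using pos assms uv by auto
    moreover have "x = ((u * a + v * b) / (a + b)) *\<^sub>R (a + b) *\<^sub>R w" using pos x by simp
    ultimately show ?thesis unfolding in_segment by (metis add_0 scaleR_zero_right)
  qed
next
  fix x assume "x \<in> closed_segment 0 ((a + b) *\<^sub>R w)"
  then obtain u where "0 \<le> u" "u \<le> 1" and x: "x = u *\<^sub>R a *\<^sub>R w + u *\<^sub>R b *\<^sub>R w"
    by (auto simp: in_segment algebra_simps)
  then have "u *\<^sub>R a *\<^sub>R w \<in> closed_segment 0 (a *\<^sub>R w)" "u *\<^sub>R b *\<^sub>R w \<in> closed_segment 0 (b *\<^sub>R w)"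
    by (auto simp: in_segment)
  then show "x \<in> closed_segment 0 (a *\<^sub>R w) + closed_segment 0 (b *\<^sub>R w)"
    unfolding x by (rule set_plus_intro)
qed

lemma sum_closed_segment_scaleR:
  fixes w :: "'a::real_normed_vector"
  assumes "finite I" "\<And>i. i \<in> I \<Longrightarrow> 0 \<le> c i"
  shows "(\<Sum>i\<in>I. closed_segment 0 (c i *\<^sub>R w)) = closed_segment 0 ((\<Sum>i\<in>I. c i) *\<^sub>R w)"
  using assms
proof (induction rule: finite_induct)
  case (insert i I)
  then show ?case by (simp add: closed_segment_scaleR_add sum_nonneg)
qed (simp add: set_zero)

lemma closed_segment_eq_translate:
  fixes a b :: "'a::real_normed_vector"
  shows "closed_segment a b = {a} + closed_segment 0 (b - a)"
proof -
  have "{a} + closed_segment 0 (b - a) = (+) a ` closed_segment 0 (b - a)"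
    by (auto simp: set_plus_def)
  also have "\<dots> = closed_segment a b" by (simp flip: closed_segment_translation)
  finally show ?thesis by simp
qed

lemma sum_singleton_sets: "finite I \<Longrightarrow> (\<Sum>i\<in>I. {a i}) = {\<Sum>i\<in>I. a i :: 'a::comm_monoid_add}"
  by (induction rule: finite_induct) (auto simp: set_zero set_plus_def)

lemma zonotope_is_zono:
  fixes A :: "(real ^ 'n) set"
  assumes "A \<in> zonotopes m"
  shows "\<exists>p k T. A = zono p k T \<and> (\<forall>i. 0 \<le> T d i)"
proof -
  obtain k :: nat and a b :: "nat \<Rightarrow> real ^ 'n" where A: "A = (\<Sum>i<k. closed_segment (a i) (b i))"
    using assms unfolding zonotopes_def by (elim CollectE exE conjE) (rule that)
  \<comment> \<open>Swapping endpoints leaves a segment unchanged; each one is oriented so that its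
    generator has nonnegative \<open>d\<close>-coordinate.\<close>
  define a' where "a' = (\<lambda>i. if a i $ d \<le> b i $ d then a i else b i)"
  define b' where "b' = (\<lambda>i. if a i $ d \<le> b i $ d then b i else a i)"
  define T where "T = (\<lambda>l i. (b' i - a' i) $ l)"
  have "closed_segment (a i) (b i) = {a' i} + closed_segment 0 (\<chi> l. T l i)" for i
  proof -
    have "closed_segment (a i) (b i) = closed_segment (a' i) (b' i)"
      by (simp add: a'_def b'_def insert_commute)
    also have "\<dots> = {a' i} + closed_segment 0 (b' i - a' i)" by (rule closed_segment_eq_translate)
    also have "b' i - a' i = (\<chi> l. T l i)" by (simp add: T_def vec_eq_iff)
    finally show ?thesis .
  qed
  then have "A = zono (\<Sum>i<k. a' i) k T"
    by (simp add: A zono_eq_sum sum.distrib sum_singleton_sets)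
  moreover have "0 \<le> T d i" for i by (simp add: T_def a'_def b'_def)
  ultimately show ?thesis by blast
qed

text \<open>The translation is absorbed into the first segment, so it costs no extra generator; this
  is where \<open>S\<close> has to be nonempty.\<close>

lemma translate_sum_segments_in_zonotopes:
  fixes S :: "'e set" and v :: "'e \<Rightarrow> real ^ 'n"
  assumes "finite S" "S \<noteq> {}"
  shows "{p} + (\<Sum>e\<in>S. closed_segment 0 (v e)) \<in> zonotopes (card S)"
proof -
  obtain f where f: "bij_betw f {0..<card S} S" using ex_bij_betw_nat_finite[OF assms(1)] by blast
  define a where "a = (\<lambda>j :: nat. if j = 0 then p else 0)"
  have "0 < card S" using assms by (simp add: card_gt_0_iff)
  then have "(\<Sum>j<card S. a j) = p" by (simp add: a_def)
  then have "{p} + (\<Sum>e\<in>S. closed_segment 0 (v e))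
      = (\<Sum>j<card S. {a j}) + (\<Sum>j<card S. closed_segment 0 (v (f j)))"
    using sum.reindex_bij_betw[OF f, of "\<lambda>e. closed_segment 0 (v e)"]
    by (simp add: sum_singleton_sets lessThan_atLeast0)
  also have "\<dots> = (\<Sum>j<card S. closed_segment (a j) (a j + v (f j)))"
    by (subst closed_segment_eq_translate) (simp add: sum.distrib)
  finally have eq: "{p} + (\<Sum>e\<in>S. closed_segment 0 (v e))
      = (\<Sum>j<card S. closed_segment (a j) (a j + v (f j)))" .
  show ?thesis
    unfolding eq zonotopes_def
    by (rule CollectI, rule exI[of _ "card S"], rule conjI[OF le_refl], rule exI[of _ a],
        rule exI[of _ "\<lambda>j. a j + v (f j)"], rule refl)
qed

text \<open>Group the columns by their support outside \<open>d\<close>, a subset of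
  \<open>UNIV - {d}\<close>. The columns of one group are nonnegative multiples of one vector and
  merge into a single segment; an empty group yields a degenerate one.\<close>

lemma zono_basic_rows_in_zonotopes:
  fixes T :: "'n::finite \<Rightarrow> nat \<Rightarrow> real"
  assumes h: "\<And>i. i < k \<Longrightarrow> 0 \<le> T d i"
    and basic: "\<And>l. l \<noteq> d \<Longrightarrow> basic_row k (T d) (T l)"
  shows "zono p k T \<in> zonotopes (2 ^ (CARD('n) - 1))"
proof -
  define col :: "nat \<Rightarrow> real ^ 'n" where "col = (\<lambda>i. \<chi> l. T l i)"
  define supp where "supp = (\<lambda>i. {l. l \<noteq> d \<and> T l i \<noteq> 0})"
  define P where "P = Pow (UNIV - {d})"
  define I where "I = (\<lambda>E. {i \<in> {..<k}. supp i = E})"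
  have "\<exists>v. (\<Sum>i\<in>I E. closed_segment 0 (col i)) = closed_segment 0 v" if E: "E \<in> P" for E
  proof -
    have "\<exists>w c. \<forall>i\<in>I E. 0 \<le> c i \<and> col i = c i *\<^sub>R w"
    proof (cases "\<exists>l\<in>E. \<exists>j<k. \<forall>i<k. i \<noteq> j \<longrightarrow> T l i = 0")
      \<comment> \<open>Some row in the support has at most one nonzero entry, so the group has at
        most one column.\<close>
      case True
      then obtain l j where "l \<in> E" "\<forall>i<k. i \<noteq> j \<longrightarrow> T l i = 0" by blast
      then have "\<forall>i\<in>I E. i = j" by (auto simp: I_def supp_def)
      then show ?thesis by (intro exI[of _ "col j"] exI[of _ "\<lambda>_. 1"]) auto
    next
      \<comment> \<open>All rows in \<open>E\<close> are restrictions of row \<open>d\<close> and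
        are nonzero on this group, so there they agree with row \<open>d\<close>.\<close>
      case False
      have "T l i = T d i" if "i \<in> I E" "l \<in> E" for i l
      proof -
        have "l \<noteq> d" "i < k" "T l i \<noteq> 0" using that by (auto simp: I_def supp_def)
        then show ?thesis
          using basic[of l] False that(2) unfolding basic_row_def by metis
      qed
      moreover have "T l i = 0" if "i \<in> I E" "l \<notin> E" "l \<noteq> d" for i l
        using that by (auto simp: I_def supp_def)
      ultimately have "\<forall>i\<in>I E. col i = T d i *\<^sub>R (\<chi> l. if l \<in> insert d E then 1 else 0)"
        by (auto simp: col_def vec_eq_iff)
      moreover have "\<forall>i\<in>I E. 0 \<le> T d i" using h by (simp add: I_def)
      ultimately show ?thesis by blast
    qed
    then obtain w c where wc: "\<And>i. i \<in> I E \<Longrightarrow> 0 \<le> c i" "\<And>i. i \<in> I E \<Longrightarrow> col i = c i *\<^sub>R w"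
      by blast
    then have "(\<Sum>i\<in>I E. closed_segment 0 (col i)) = (\<Sum>i\<in>I E. closed_segment 0 (c i *\<^sub>R w))"
      by (intro sum.cong) auto
    also have "\<dots> = closed_segment 0 ((\<Sum>i\<in>I E. c i) *\<^sub>R w)"
      using wc by (intro sum_closed_segment_scaleR) (auto simp: I_def)
    finally show ?thesis by blast
  qed
  then obtain v where v: "\<And>E. E \<in> P \<Longrightarrow> (\<Sum>i\<in>I E. closed_segment 0 (col i)) = closed_segment 0 (v E)"
    by metis
  have "(\<Sum>i<k. closed_segment 0 (col i)) = (\<Sum>E\<in>P. \<Sum>i\<in>I E. closed_segment 0 (col i))"
    unfolding I_def by (rule sum.group[symmetric]) (auto simp: P_def supp_def)
  also have "\<dots> = (\<Sum>E\<in>P. closed_segment 0 (v E))" using v by (rule sum.cong[OF refl])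
  finally have "zono p k T = {p} + (\<Sum>E\<in>P. closed_segment 0 (v E))"
    by (simp add: zono_eq_sum col_def)
  also have "\<dots> \<in> zonotopes (card P)"
    by (rule translate_sum_segments_in_zonotopes) (auto simp: P_def)
  also have "card P = 2 ^ (CARD('n) - 1)" by (simp add: P_def card_Pow card_Diff_singleton)
  finally show ?thesis .
qed

section \<open>Induction over the rows\<close>

theorem mainTheorem6:
  fixes d :: "'n::finite" and m :: nat
  assumes "CARD('n) \<ge> 2"
    and "\<forall>A \<in> (zonotopes (2 ^ (CARD('n) - 1)) :: (real ^ 'n) set set). zonotope_ineq d A"
    and "m \<ge> CARD('n)"
  shows "\<forall>A \<in> (zonotopes m :: (real ^ 'n) set set). zonotope_ineq d A"
proof
  fix A :: "(real ^ 'n) set" assume "A \<in> zonotopes m"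
  from zonotope_is_zono[OF this, of d] obtain p k T where A: "A = zono p k T" and h: "\<forall>i. 0 \<le> T d i"
    by (elim exE conjE) (rule that)
  \<comment> \<open>\<open>L\<close> contains the rows that need not be basic yet. The matrix varies
    in the induction, but row \<open>d\<close>, with respect to which basic rows are defined, is
    never replaced.\<close>
  have "zonotope_ineq d (zono p k T)"
    if "finite L" "d \<notin> L" "\<And>i. 0 \<le> T d i" "\<And>l. l \<noteq> d \<Longrightarrow> l \<notin> L \<Longrightarrow> basic_row k (T d) (T l)"
    for L :: "'n set" and T :: "'n \<Rightarrow> nat \<Rightarrow> real"
    using that
  proof (induction L arbitrary: T rule: finite_induct)
    case empty
    then show ?case using assms(2) zono_basic_rows_in_zonotopes[of k T d p] by simp
  next
    case (insert l L)
    show ?case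
    proof (rule zonotope_ineq_of_basic_row[where l=l])
      show "l \<noteq> d" using insert.prems by auto
      then show "zonotope_ineq d (zono p k (T(l := \<rho>)))" if "basic_row k (T d) \<rho>" for \<rho>
        using insert.prems that by (intro insert.IH) auto
    qed (use insert.prems in auto)
  qed
  from this[of "UNIV - {d}" T] show "zonotope_ineq d A" using h by (simp add: A)
qed

end
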